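(* For every metric space $(X,d_X)$ and every $d\in\mathbb N$ there exists $N=N(d,X)\in\mathbb N$ such that $$c_{\ell_2^N(X)}\big(\mathbb F_2^d,\|\cdot\|_{p_X}\big)\le \mathrm{BMW}_{p_X}(X)^2 .$$
   Context: All metric spaces are assumed to contain at least two points. Let $\mathbb F_2$ be the field with two elements, $e_1,\ldots,e_n$ the standard basis of $\mathbb F_2^n$, and $e=e_1+\cdots+e_n$. For $p\in(0,\infty)$ and a metric space $(X,d_X)$, $\mathrm{BMW}_p(X)$ is the infimum over those $T\in(0,\infty)$ such that for every $n\in\mathbb N$ every $f:\mathbb F_2^n\to X$ satisfies $$\sum_{x\in\mathbb F_2^n}d_X(f(x),f(x+e))^2\le T^2n^{\frac2p-1}\sum_{i=1}^n\sum_{x\in\mathbb F_2^n}d_X(f(x),f(x+e_i))^2,$$ with $\mathrm{BMW}_p(X)=\infty$ if no such $T$ exists. Define $p_X=\sup\{p\in[1,2]:\mathrm{BMW}_p(X)<\infty\}$ (every metric space satisfies $\mathrm{BMW}_1(X)<\infty$). $(\mathbb F_2^d,\|\cdot\|_p)$ denotes the set $\{0,1\}^d\subset\mathbb R^d$ (identified with $\mathbb F_2^d$) with the metric $\|x-y\|_p$ inherited from $\ell_p^d$. $\ell_2^N(X)$ is $X^N$ with the metric $\big(\sum_{i=1}^N d_X(x_i,y_i)^2\big)^{1/2}$. For metric spaces $(U,d_U),(V,d_V)$, $c_V(U)$ is the infimum over those $D\in[1,\infty)$ for which there exist $s\in(0,\infty)$ and $f:U\to V$ with $s\,d_U(x,y)\le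 d_V(f(x),f(y))\le Ds\,d_U(x,y)$ for all $x,y\in U$ ($c_V(U)=\infty$ if no such $D$ exists). *)

theory Defs
  imports "HOL-Analysis.Analysis" "HOL-Library.Z2" "HOL-Library.Function_Algebras"
begin

text \<open>
  The vector space of dimension \<open>n\<close> over the field \<^typ>\<open>bit\<close> with two elements: vectors are
  functions on the natural numbers that vanish outside \<open>{..<n}\<close> (coordinates are indexed
  from \<open>0\<close>), with the pointwise addition of \<^theory>\<open>HOL-Library.Function_Algebras\<close>.
\<close>

definition F2 :: "nat \<Rightarrow> (nat \<Rightarrow> bit) set" where
  "F2 n = {x. \<forall>i\<ge>n. x i = 0}"

definition F2_basis :: "nat \<Rightarrow> nat \<Rightarrow> bit" where
  "F2_basis i = (\<lambda>j. if j = i then 1 else 0)"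

definition F2_ones :: "nat \<Rightarrow> nat \<Rightarrow> bit" where
  "F2_ones n = (\<Sum>i<n. F2_basis i)"

text \<open>
  Metric spaces are given by a carrier and a distance function. Values of \<open>f\<close> outside
  \<^term>\<open>F2 n\<close> are irrelevant.
\<close>

definition BMW_ineq :: "real \<Rightarrow> 'a set \<Rightarrow> ('a \<Rightarrow> 'a \<Rightarrow> real) \<Rightarrow> real \<Rightarrow> bool" where
  "BMW_ineq p X dX T \<longleftrightarrow>
     (\<forall>n\<ge>1. \<forall>f \<in> F2 n \<rightarrow> X.
        (\<Sum>x\<in>F2 n. (dX (f x) (f (x + F2_ones n)))\<^sup>2)
          \<le> T\<^sup>2 * real n powr (2 / p - 1)
              * (\<Sum>i<n. \<Sum>x\<in>F2 n. (dX (f x) (f (x + F2_basis i)))\<^sup>2))"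

definition BMW :: "real \<Rightarrow> 'a set \<Rightarrow> ('a \<Rightarrow> 'a \<Rightarrow> real) \<Rightarrow> ennreal" where
  "BMW p X dX = Inf {ennreal T |T. 0 < T \<and> BMW_ineq p X dX T}"

text \<open>
  The set below contains \<open>1\<close> for every metric space and is bounded by \<open>2\<close>, so the supremum of
  reals is meaningful.
\<close>

definition BMW_exponent :: "'a set \<Rightarrow> ('a \<Rightarrow> 'a \<Rightarrow> real) \<Rightarrow> real" where
  "BMW_exponent X dX = Sup {p. 1 \<le> p \<and> p \<le> 2 \<and> BMW p X dX < \<infinity>}"

definition lp_dist :: "real \<Rightarrow> nat \<Rightarrow> (nat \<Rightarrow> real) \<Rightarrow> (nat \<Rightarrow> real) \<Rightarrow> real" where
  "lp_dist p d x y = (\<Sum>i<d. \<bar>x i - y i\<bar> powr p) powr (1 / p)"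

definition F2_dist :: "real \<Rightarrow> nat \<Rightarrow> (nat \<Rightarrow> bit) \<Rightarrow> (nat \<Rightarrow> bit) \<Rightarrow> real" where
  "F2_dist p d x y = lp_dist p d (\<lambda>i. of_bool (x i = 1)) (\<lambda>i. of_bool (y i = 1))"

definition l2_carrier :: "nat \<Rightarrow> 'a set \<Rightarrow> (nat \<Rightarrow> 'a) set" where
  "l2_carrier N X = (\<Pi>\<^sub>E i\<in>{..<N}. X)"

definition l2_dist :: "nat \<Rightarrow> ('a \<Rightarrow> 'a \<Rightarrow> real) \<Rightarrow> (nat \<Rightarrow> 'a) \<Rightarrow> (nat \<Rightarrow> 'a) \<Rightarrow> real" where
  "l2_dist N dX x y = L2_set (\<lambda>i. dX (x i) (y i)) {..<N}"

definition distortion ::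
  "'v set \<Rightarrow> ('v \<Rightarrow> 'v \<Rightarrow> real) \<Rightarrow> 'u set \<Rightarrow> ('u \<Rightarrow> 'u \<Rightarrow> real) \<Rightarrow> ennreal" where
  "distortion V dV U dU = Inf {ennreal D |D. 1 \<le> D \<and>
     (\<exists>s>0. \<exists>f \<in> U \<rightarrow> V. \<forall>x\<in>U. \<forall>y\<in>U.
        s * dU x y \<le> dV (f x) (f y) \<and> dV (f x) (f y) \<le> D * s * dU x y)}"

end

theory Submission
  imports Defs
begin

text \<open>
  The best constant in the inequality on the \<open>n\<close>-dimensional cube is submultiplicative in \<open>n\<close>, so
  by maximality of \<open>p = p\<^sub>X\<close> it is at least \<open>n\<close> to the power \<open>2/p - 1\<close> for every \<open>n\<close>. Take an almost
  extremal \<open>f\<close> on a cube whose dimension \<open>n\<close> is divisible by all \<open>k \<le> d\<close>, and symmetrize it over all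
  coordinate permutations and translations. The induced metric \<open>\<rho>\<close> then depends only on the Hamming
  distance \<open>k\<close>. The inequality bounds \<open>\<rho>(k)\<close> above by \<open>T k\<^bsup>1/p\<^esup> \<rho>(1)\<close>; applied to \<open>n/k\<close> blocks
  of size \<open>k\<close> it bounds \<open>\<rho>(n)\<close> above by \<open>T (n/k)\<^bsup>1/p\<^esup> \<rho>(k)\<close>, and since \<open>\<rho>(n)\<close> is almost
  \<open>n\<^bsup>1/p\<^esup> \<rho>(1)\<close> by extremality, this is a lower bound for \<open>\<rho>(k)\<close> that matches up to a factor \<open>T\<^sup>2\<close>.
\<close>

section \<open>The cube as a finite group of exponent two\<close>

lemma bit_vec_add_self [simp]: "x + x = (0 :: 'a \<Rightarrow> bit)"
  by (rule ext) simp

lemma sum_fun_app: "(\<Sum>a\<in>A. f a) j = (\<Sum>a\<in>A. f a (j :: 'b) :: 'c :: comm_monoid_add)"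
  by (induction A rule: infinite_finite_induct) auto

lemma F2_0 [simp]: "0 \<in> F2 n"
  by (simp add: F2_def)

lemma F2_add [simp]: "x \<in> F2 n \<Longrightarrow> y \<in> F2 n \<Longrightarrow> x + y \<in> F2 n"
  by (simp add: F2_def)

declare plus_fun_apply [simp del]

lemma F2_sum: "(\<And>a. a \<in> A \<Longrightarrow> v a \<in> F2 n) \<Longrightarrow> (\<Sum>a\<in>A. v a) \<in> F2 n"
  by (induction A rule: infinite_finite_induct) auto

lemma F2_basis_mem [simp]: "i < n \<Longrightarrow> F2_basis i \<in> F2 n"
  by (simp add: F2_def F2_basis_def)

lemma F2_ones_mem [simp]: "F2_ones n \<in> F2 n"
  unfolding F2_ones_def by (rule F2_sum) simp

lemma sum_F2_basis: "finite A \<Longrightarrow> (\<Sum>i\<in>A. F2_basis i) = (\<lambda>j. of_bool (j \<in> A))"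
  by (rule ext) (simp add: sum_fun_app F2_basis_def)

lemma F2_mono: "m \<le> n \<Longrightarrow> F2 m \<subseteq> F2 n"
  by (auto simp: F2_def)

lemma finite_F2 [simp]: "finite (F2 n)"
proof (rule inj_on_finite)
  show "inj_on (\<lambda>x. {i. x i = 1}) (F2 n)"
  proof (rule inj_onI, rule ext)
    fix x y :: "nat \<Rightarrow> bit" and i
    assume "{i. x i = 1} = {i. y i = 1}"
    then have "x i = 1 \<longleftrightarrow> y i = 1" by blast
    then show "x i = y i" by (cases "x i"; cases "y i") auto
  qed
  show "(\<lambda>x. {i. x i = 1}) ` F2 n \<subseteq> Pow {..<n}"
    by (fastforce simp: F2_def not_le[symmetric])
qed simp

lemma sum_F2_translate:
  assumes "v \<in> F2 n"
  shows "(\<Sum>x\<in>F2 n. g (x + v)) = (\<Sum>x\<in>F2 n. g x)"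
  by (rule sum.reindex_bij_witness[where i = "\<lambda>x. x + v" and j = "\<lambda>x. x + v"])
    (use assms in \<open>auto simp: add.assoc\<close>)

section \<open>Energies and the inequality on a single cube\<close>

definition energy :: "('a \<Rightarrow> 'a \<Rightarrow> real) \<Rightarrow> nat \<Rightarrow> ((nat \<Rightarrow> bit) \<Rightarrow> 'a) \<Rightarrow> (nat \<Rightarrow> bit) \<Rightarrow> real"
  where "energy dX n f v = (\<Sum>x\<in>F2 n. (dX (f x) (f (x + v)))\<^sup>2)"

text \<open>Fixing the dimension and leaving the constant free allows constants of different
  dimensions to be compared and multiplied.\<close>

definition cube_ineq :: "'a set \<Rightarrow> ('a \<Rightarrow> 'a \<Rightarrow> real) \<Rightarrow> nat \<Rightarrow> real \<Rightarrow> bool"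
  where "cube_ineq X dX k C \<longleftrightarrow> (\<forall>f\<in>F2 k \<rightarrow> X.
    energy dX k f (F2_ones k) \<le> C * (\<Sum>i<k. energy dX k f (F2_basis i)))"

lemma BMW_ineq_iff_cube_ineq:
  "BMW_ineq p X dX T \<longleftrightarrow> (\<forall>n\<ge>1. cube_ineq X dX n (T\<^sup>2 * real n powr (2 / p - 1)))"
  by (simp add: BMW_ineq_def cube_ineq_def energy_def)

lemma energy_nonneg [simp]: "0 \<le> energy dX n f v"
  by (simp add: energy_def sum_nonneg)

lemma energy_translate:
  assumes "w \<in> F2 n"
  shows "(\<Sum>x\<in>F2 n. (dX (f (x + w)) (f (x + w + v)))\<^sup>2) = energy dX n f v"
  unfolding energy_def
  using sum_F2_translate[OF assms, of "\<lambda>x. (dX (f x) (f (x + v)))\<^sup>2"] by simp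

text \<open>
  Apply the inequality to the pullback of \<open>f\<close> along every affine map
  \<open>y \<mapsto> z + (\<Sum>i<k. y i v\<^sub>i)\<close> and average over \<open>z\<close>.
\<close>
lemma cube_ineq_energy_lessThan:
  assumes "cube_ineq X dX k C" "f \<in> F2 n \<rightarrow> X" and v: "\<And>i. i < k \<Longrightarrow> v i \<in> F2 n"
  shows "energy dX n f (\<Sum>i<k. v i) \<le> C * (\<Sum>i<k. energy dX n f (v i))"
proof -
  define L where "L y = (\<Sum>i<k. (\<lambda>j. y i * v i j))" for y :: "nat \<Rightarrow> bit"
  have L_add: "L (y + y') = L y + L y'" for y y'
    by (rule ext) (simp only: L_def sum_fun_app plus_fun_apply distrib_right sum.distrib)
  have L_mem: "L y \<in> F2 n" for y
    unfolding L_def by (rule F2_sum) (use v in \<open>auto simp: F2_def\<close>)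
  have L_basis: "L (F2_basis i) = v i" if "i < k" for i
  proof (rule ext)
    fix j
    have "L (F2_basis i) j = (\<Sum>l<k. if l = i then v l j else 0)"
      unfolding L_def sum_fun_app by (rule sum.cong) (auto simp: F2_basis_def)
    then show "L (F2_basis i) j = v i j" using that by simp
  qed
  have "L (F2_ones k) = (\<Sum>i<k. L (F2_basis i))"
  proof -
    have "L (\<Sum>i\<in>A. F2_basis i) = (\<Sum>i\<in>A. L (F2_basis i))" if "finite A" for A
      using that
    proof (induction A)
      case empty
      show ?case by (simp add: L_def fun_eq_iff sum_fun_app)
    qed (simp add: L_add)
    then show ?thesis by (simp add: F2_ones_def)
  qed
  then have L_ones: "L (F2_ones k) = (\<Sum>i<k. v i)"
    using L_basis by simp
  have avg: "(\<Sum>z\<in>F2 n. energy dX k (\<lambda>y. f (z + L y)) u) = card (F2 k) * energy dX n f (L u)" for u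
  proof -
    have "(\<Sum>z\<in>F2 n. energy dX k (\<lambda>y. f (z + L y)) u)
      = (\<Sum>y\<in>F2 k. \<Sum>z\<in>F2 n. (dX (f (z + L y)) (f (z + L y + L u)))\<^sup>2)"
      unfolding energy_def by (subst sum.swap) (simp add: L_add add.assoc)
    also have "\<dots> = (\<Sum>y\<in>F2 k. energy dX n f (L u))"
      by (intro sum.cong refl energy_translate L_mem)
    finally show ?thesis by simp
  qed
  have "(\<Sum>z\<in>F2 n. energy dX k (\<lambda>y. f (z + L y)) (F2_ones k))
    \<le> (\<Sum>z\<in>F2 n. C * (\<Sum>i<k. energy dX k (\<lambda>y. f (z + L y)) (F2_basis i)))"
    using assms(1,2) L_mem by (intro sum_mono) (auto simp: cube_ineq_def Pi_def)
  also have "\<dots> = C * (\<Sum>i<k. \<Sum>z\<in>F2 n. energy dX k (\<lambda>y. f (z + L y)) (F2_basis i))"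
    by (subst sum.swap) (simp add: sum_distrib_left)
  finally have "card (F2 k) * energy dX n f (\<Sum>i<k. v i)
    \<le> C * (\<Sum>i<k. card (F2 k) * energy dX n f (v i))"
    by (simp add: avg L_ones L_basis)
  also have "\<dots> = card (F2 k) * (C * (\<Sum>i<k. energy dX n f (v i)))"
    by (simp add: sum_distrib_left mult_ac)
  finally have "card (F2 k) * energy dX n f (\<Sum>i<k. v i)
    \<le> card (F2 k) * (C * (\<Sum>i<k. energy dX n f (v i)))" .
  moreover have "card (F2 k) > 0"
    using F2_0[of k] by (auto simp: card_gt_0_iff simp del: F2_0)
  ultimately show ?thesis by simp
qed

lemma cube_ineq_energy:
  assumes "cube_ineq X dX (card A) C" "f \<in> F2 n \<rightarrow> X" "finite A" and v: "\<And>a. a \<in> A \<Longrightarrow> v a \<in> F2 n"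
  shows "energy dX n f (\<Sum>a\<in>A. v a) \<le> C * (\<Sum>a\<in>A. energy dX n f (v a))"
proof -
  obtain h where h: "bij_betw h {..<card A} A"
    using ex_bij_betw_nat_finite[OF assms(3)] by (auto simp: atLeast0LessThan)
  have "energy dX n f (\<Sum>i<card A. v (h i)) \<le> C * (\<Sum>i<card A. energy dX n f (v (h i)))"
    using assms(1,2) by (rule cube_ineq_energy_lessThan) (use h v in \<open>auto simp: bij_betw_def\<close>)
  then show ?thesis
    using sum.reindex_bij_betw[OF h, of v] sum.reindex_bij_betw[OF h, of "\<lambda>a. energy dX n f (v a)"]
    by simp
qed

text \<open>Split the \<open>m * n\<close> coordinates into \<open>m\<close> blocks of length
  \<open>n\<close>: the first inequality handles the block sums, the second the basis vectors within
  each block.\<close>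

lemma cube_ineq_mult:
  assumes m: "cube_ineq X dX m C" and n: "cube_ineq X dX n D" and "0 \<le> C"
  shows "cube_ineq X dX (m * n) (C * D)"
  unfolding cube_ineq_def
proof
  fix f assume f: "f \<in> F2 (m * n) \<rightarrow> X"
  let ?E = "energy dX (m * n) f" and ?B = "\<lambda>i. {i * n..<i * n + n}"
  have B: "F2_basis j \<in> F2 (m * n)" if "i < m" "j \<in> ?B i" for i j
  proof -
    have "Suc i * n \<le> m * n" using that by (intro mult_right_mono) auto
    then show ?thesis using that by auto
  qed
  have "?E (F2_ones (m * n)) = ?E (\<Sum>i<m. \<Sum>j\<in>?B i. F2_basis j)"
    by (simp add: F2_ones_def sum.nat_group)
  also have "\<dots> \<le> C * (\<Sum>i<m. ?E (\<Sum>j\<in>?B i. F2_basis j))"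
    using m f by (rule cube_ineq_energy_lessThan) (blast intro: F2_sum B)
  also have "\<dots> \<le> C * (\<Sum>i<m. D * (\<Sum>j\<in>?B i. ?E (F2_basis j)))"
    using n f \<open>0 \<le> C\<close> by (intro mult_left_mono sum_mono cube_ineq_energy) (auto intro: B)
  also have "\<dots> = C * D * (\<Sum>j<m * n. ?E (F2_basis j))"
    by (simp add: sum_distrib_left[symmetric] sum.nat_group)
  finally show "?E (F2_ones (m * n)) \<le> C * D * (\<Sum>j<m * n. ?E (F2_basis j))" .
qed

section \<open>Consequences of the metric axioms\<close>

lemma (in Metric_space) energy_zero [simp]: "f \<in> F2 n \<rightarrow> M \<Longrightarrow> energy d n f 0 = 0"
  by (simp add: energy_def Pi_def)

text \<open>Padding the \<open>r\<close> basis vectors with \<open>n - r\<close> zero vectors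
  changes neither their sum nor their total energy, since the zero vector has zero energy.\<close>

lemma (in Metric_space) cube_ineq_antimono:
  assumes "cube_ineq M d n C" "r \<le> n"
  shows "cube_ineq M d r C"
  unfolding cube_ineq_def
proof
  fix f assume f: "f \<in> F2 r \<rightarrow> M"
  let ?v = "\<lambda>i. if i < r then F2_basis i else 0"
  have eq: "(\<Sum>i<n. if i < r then g i else 0) = (\<Sum>i<r. g i)" for g :: "nat \<Rightarrow> 'b :: comm_monoid_add"
    using assms(2) by (intro sum.mono_neutral_cong_right) auto
  have "energy d r f (\<Sum>i<n. ?v i) \<le> C * (\<Sum>i<n. energy d r f (?v i))"
    using assms(1) f by (rule cube_ineq_energy_lessThan) auto
  moreover have "(\<Sum>i<n. energy d r f (?v i)) = (\<Sum>i<r. energy d r f (F2_basis i))"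
    unfolding eq[symmetric] by (rule sum.cong) (use f in auto)
  ultimately show "energy d r f (F2_ones r) \<le> C * (\<Sum>i<r. energy d r f (F2_basis i))"
    by (simp add: eq F2_ones_def)
qed

text \<open>Flip the coordinates one at a time: the triangle inequality bounds the diagonal by the
  \<open>n\<close> edges of this path, and Cauchy-Schwarz costs the factor \<open>n\<close>.\<close>

lemma (in Metric_space) cube_ineq_trivial: "cube_ineq M d n (real n)"
  unfolding cube_ineq_def
proof
  fix f assume f: "f \<in> F2 n \<rightarrow> M"
  define s where "s i = (\<Sum>j<i. F2_basis j)" for i
  have s: "s i \<in> F2 n" if "i \<le> n" for i
    unfolding s_def using that by (intro F2_sum) auto
  have dist: "d (f x) (f (x + s k)) \<le> (\<Sum>i<k. d (f (x + s i)) (f (x + s i + F2_basis i)))"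
    if x: "x \<in> F2 n" and "k \<le> n" for x k
    using \<open>k \<le> n\<close>
  proof (induction k)
    case 0
    have "s 0 = 0" by (simp add: s_def)
    then have "f (x + s 0) = f x" by (simp only: add_0_right)
    then show ?case using f x by (simp add: Pi_def)
  next
    case (Suc k)
    have "d (f x) (f (x + s (Suc k))) \<le> d (f x) (f (x + s k)) + d (f (x + s k)) (f (x + s (Suc k)))"
      using f x s[of k] s[of "Suc k"] Suc.prems by (intro triangle) auto
    moreover have "x + s (Suc k) = x + s k + F2_basis k"
      by (simp add: s_def add.assoc)
    ultimately show ?case using Suc by (simp add: add.assoc)
  qed
  have "energy d n f (F2_ones n) = (\<Sum>x\<in>F2 n. (d (f x) (f (x + s n)))\<^sup>2)"
    by (simp add: energy_def F2_ones_def s_def)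
  also have "\<dots> \<le> (\<Sum>x\<in>F2 n. real n * (\<Sum>i<n. (d (f (x + s i)) (f (x + s i + F2_basis i)))\<^sup>2))"
  proof (rule sum_mono)
    fix x :: "nat \<Rightarrow> bit" assume "x \<in> F2 n"
    then have "(d (f x) (f (x + s n)))\<^sup>2 \<le> (\<Sum>i<n. d (f (x + s i)) (f (x + s i + F2_basis i)))\<^sup>2"
      using dist by (intro power_mono) auto
    also have "\<dots> \<le> (\<Sum>i<n. (d (f (x + s i)) (f (x + s i + F2_basis i)))\<^sup>2) * card {..<n}"
      by (rule sum_squared_le_sum_of_squares)
    finally show "(d (f x) (f (x + s n)))\<^sup>2
      \<le> real n * (\<Sum>i<n. (d (f (x + s i)) (f (x + s i + F2_basis i)))\<^sup>2)"
      by (simp add: mult.commute)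
  qed
  also have "\<dots> = real n * (\<Sum>i<n. \<Sum>x\<in>F2 n. (d (f (x + s i)) (f (x + s i + F2_basis i)))\<^sup>2)"
    by (subst sum.swap) (simp add: sum_distrib_left)
  \<comment> \<open>Translation by \<open>s i\<close> maps the cube to itself, so the position of an
    edge on the path does not matter after summation over \<open>x\<close>.\<close>
  also have "\<dots> = real n * (\<Sum>i<n. energy d n f (F2_basis i))"
    using s by (simp add: energy_translate)
  finally show "energy d n f (F2_ones n) \<le> real n * (\<Sum>i<n. energy d n f (F2_basis i))" .
qed

text \<open>In dimension one the diagonal is the only edge, so a function with two distinct values
  has the same positive energy on both sides.\<close>

lemma (in Metric_space) cube_ineq_ge_1:
  assumes "cube_ineq M d n C" "1 \<le> n" "a \<in> M" "b \<in> M" "a \<noteq> b"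
  shows "1 \<le> C"
proof -
  define f where "f x = (if x 0 = (1 :: bit) then a else b)" for x :: "nat \<Rightarrow> bit"
  have "cube_ineq M d 1 C"
    using assms(1,2) by (rule cube_ineq_antimono)
  moreover have "f \<in> F2 1 \<rightarrow> M" using assms by (auto simp: f_def)
  ultimately have "energy d 1 f (F2_ones 1) \<le> C * (\<Sum>i<1. energy d 1 f (F2_basis i))"
    unfolding cube_ineq_def by blast
  then have le: "energy d 1 f (F2_basis 0) \<le> C * energy d 1 f (F2_basis 0)"
    by (simp add: F2_ones_def)
  have "0 < (d (f 0) (f (0 + F2_basis 0)))\<^sup>2"
    using assms by (auto simp: f_def F2_basis_def)
  also have "\<dots> \<le> energy d 1 f (F2_basis 0)"
    unfolding energy_def
    using member_le_sum[of 0 "F2 1" "\<lambda>x. (d (f x) (f (x + F2_basis 0)))\<^sup>2"] by simp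
  finally show ?thesis using le by simp
qed

section \<open>Maximality of the exponent\<close>

lemma BMW_less_top_iff: "BMW p X dX < \<infinity> \<longleftrightarrow> (\<exists>T>0. BMW_ineq p X dX T)"
  by (auto simp: BMW_def Inf_less_iff)

lemma (in Metric_space) BMW_1_less_top: "BMW 1 M d < \<infinity>"
  unfolding BMW_less_top_iff
  \<comment> \<open>For \<open>p = 1\<close> the power \<open>2 / p - 1\<close> is \<open>1\<close>,
    so \<open>T = 1\<close> gives exactly the constant \<open>n\<close>.\<close>
  using cube_ineq_trivial by (intro exI[of _ 1]) (auto simp: BMW_ineq_iff_cube_ineq)

lemma (in Metric_space) BMW_exponent_bounds:
  "1 \<le> BMW_exponent M d" "BMW_exponent M d \<le> 2"
  "\<lbrakk>1 \<le> q; q \<le> 2; BMW q M d < \<infinity>\<rbrakk> \<Longrightarrow> q \<le> BMW_exponent M d"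
proof -
  let ?S = "{p. 1 \<le> p \<and> p \<le> 2 \<and> BMW p M d < \<infinity>}"
  have bdd: "bdd_above ?S" by (rule bdd_aboveI[of _ 2]) auto
  have one: "1 \<in> ?S" using BMW_1_less_top by simp
  show "1 \<le> BMW_exponent M d"
    unfolding BMW_exponent_def using one bdd by (rule cSup_upper)
  show "BMW_exponent M d \<le> 2"
    unfolding BMW_exponent_def by (rule cSup_least) (use one in blast)+
  show "q \<le> BMW_exponent M d" if "1 \<le> q" "q \<le> 2" "BMW q M d < \<infinity>"
    unfolding BMW_exponent_def by (rule cSup_upper) (use that bdd in auto)
qed

text \<open>
  By submultiplicativity, a good constant on one cube propagates to all cubes and would give
  a type larger than the supremum \<open>BMW_exponent M d\<close>.
\<close>
lemma (in Metric_space) cube_ineq_ge_powr_BMW_exponent: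
  assumes C: "cube_ineq M d m C" and m: "2 \<le> m" and ab: "a \<in> M" "b \<in> M" "a \<noteq> b"
  shows "real m powr (2 / BMW_exponent M d - 1) \<le> C"
proof (rule ccontr)
  assume neg: "\<not> ?thesis"
  let ?p = "BMW_exponent M d"
  have C1: "1 \<le> C" using cube_ineq_ge_1[OF C _ ab] m by simp
  \<comment> \<open>Writing \<open>C\<close> as \<open>m powr s\<close> turns the negated claim into
    \<open>s < 2 / ?p - 1\<close>.\<close>
  define s where "s = log m C"
  have ms: "real m powr s = C" using m C1 by (simp add: s_def)
  have s0: "0 \<le> s" using m C1 by (simp add: s_def)
  have "real m powr s < real m powr (2 / ?p - 1)" using neg ms by simp
  then have s1: "s < 2 / ?p - 1" using m by simp
  have pw: "cube_ineq M d (m ^ k) (C ^ k)" for k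
  proof (induction k)
    case 0
    show ?case using cube_ineq_trivial[of 1] by simp
  next
    case (Suc k)
    then show ?case using cube_ineq_mult[OF C Suc] C1 by simp
  qed
  \<comment> \<open>The solution of \<open>2 / q - 1 = s\<close>; hence \<open>?p < q\<close>, and
    \<open>q \<le> 2\<close> because \<open>C \<ge> 1\<close> makes \<open>s\<close>
    nonnegative.\<close>
  define q where "q = 2 / (1 + s)"
  have q: "2 / q - 1 = s" using s0 by (simp add: q_def add_divide_distrib)
  have q2: "q \<le> 2" using s0 by (simp add: q_def field_simps)
  have "0 < ?p" using BMW_exponent_bounds(1) by linarith
  moreover have "1 + s < 2 / ?p" using s1 by simp
  ultimately have "(1 + s) * ?p < 2" by (simp only: pos_less_divide_eq)
  then have pq: "?p < q"
    using s0 by (simp add: q_def pos_less_divide_eq mult.commute)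
  have "BMW_ineq q M d (sqrt C)"
    unfolding BMW_ineq_iff_cube_ineq
  proof (intro allI impI)
    fix r :: nat assume r: "1 \<le> r"
    \<comment> \<open>Rounding \<open>r\<close> up to a power of \<open>m\<close> costs one extra
      factor \<open>C\<close>, which \<open>T = sqrt C\<close> absorbs; the rest is
      \<open>C ^ k = (m ^ k) powr s \<le> r powr s\<close>.\<close>
    obtain k where k: "m ^ k \<le> r" "r < m ^ (k + 1)"
      using ex_power_ivl1[OF m r] by auto
    have "cube_ineq M d r (C ^ (k + 1))"
      using k(2) by (intro cube_ineq_antimono[OF pw]) (rule less_imp_le)
    moreover have "C ^ (k + 1) \<le> (sqrt C)\<^sup>2 * real r powr (2 / q - 1)"
    proof -
      have "C ^ k = real (m ^ k) powr s"
      proof -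
        have "C ^ k = (real m powr s) powr real k"
          using C1 by (simp add: ms powr_realpow)
        also have "\<dots> = (real m powr real k) powr s"
          by (simp add: powr_powr mult.commute)
        finally show ?thesis using m by (simp add: powr_realpow)
      qed
      also have "\<dots> \<le> real r powr s"
        using k(1) s0 m by (intro powr_mono2) (auto simp flip: of_nat_power)
      finally show ?thesis using C1 by (simp add: q)
    qed
    ultimately show "cube_ineq M d r ((sqrt C)\<^sup>2 * real r powr (2 / q - 1))"
      unfolding cube_ineq_def
      by (meson energy_nonneg mult_right_mono order_trans sum_nonneg)
  qed
  then have "BMW q M d < \<infinity>"
    using C1 unfolding BMW_less_top_iff by (intro exI[of _ "sqrt C"]) auto
  then show False
    using BMW_exponent_bounds(1) BMW_exponent_bounds(3)[of q] q2 pq by auto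
qed

section \<open>Symmetrization over coordinate permutations\<close>

text \<open>Up to normalization, the square of the symmetrized metric \<open>\<rho>\<close> at two
  points that differ by \<open>v\<close>.\<close>

definition sym_energy :: "('a \<Rightarrow> 'a \<Rightarrow> real) \<Rightarrow> nat \<Rightarrow> ((nat \<Rightarrow> bit) \<Rightarrow> 'a) \<Rightarrow> (nat \<Rightarrow> bit) \<Rightarrow> real"
  where "sym_energy dX n f v = (\<Sum>\<sigma> | \<sigma> permutes {..<n}. energy dX n f (v \<circ> \<sigma>))"

text \<open>The Hamming weight, meaningful on \<open>F2 n\<close>, where supports are
  finite.\<close>

definition weight :: "(nat \<Rightarrow> bit) \<Rightarrow> nat"
  where "weight x = card {i. x i = 1}"

lemma F2_comp_permutes: "\<sigma> permutes {..<n} \<Longrightarrow> x \<in> F2 n \<Longrightarrow> x \<circ> \<sigma> \<in> F2 n"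
  by (auto simp: F2_def permutes_def)

lemma sum_comp_fun: "(\<Sum>a\<in>A. v a) \<circ> \<sigma> = (\<Sum>a\<in>A. (v a :: _ \<Rightarrow> 'c :: comm_monoid_add) \<circ> \<sigma>)"
  by (rule ext) (simp add: sum_fun_app)

text \<open>Composition with a permutation is additive and preserves \<open>F2 n\<close>, so the
  inequality holds for each permutation separately and can be summed.\<close>

lemma cube_ineq_sym_energy:
  assumes "cube_ineq X dX (card A) C" "f \<in> F2 n \<rightarrow> X" "finite A" and v: "\<And>a. a \<in> A \<Longrightarrow> v a \<in> F2 n"
  shows "sym_energy dX n f (\<Sum>a\<in>A. v a) \<le> C * (\<Sum>a\<in>A. sym_energy dX n f (v a))"
proof -
  have "sym_energy dX n f (\<Sum>a\<in>A. v a)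
    \<le> (\<Sum>\<sigma> | \<sigma> permutes {..<n}. C * (\<Sum>a\<in>A. energy dX n f (v a \<circ> \<sigma>)))"
    unfolding sym_energy_def sum_comp_fun
    using assms by (intro sum_mono cube_ineq_energy) (auto intro: F2_comp_permutes)
  also have "\<dots> = C * (\<Sum>\<sigma> | \<sigma> permutes {..<n}. \<Sum>a\<in>A. energy dX n f (v a \<circ> \<sigma>))"
    by (simp add: sum_distrib_left)
  also have "\<dots> = C * (\<Sum>a\<in>A. sym_energy dX n f (v a))"
    unfolding sym_energy_def by (subst sum.swap) (rule refl)
  finally show ?thesis .
qed

text \<open>Glue a bijection from \<open>A\<close> to \<open>B\<close> with one between their
  complements in \<open>S\<close>, and fix everything outside \<open>S\<close>.\<close>

lemma ex_permutes_image:
  assumes "finite S" "A \<subseteq> S" "B \<subseteq> S" "card A = card B"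
  shows "\<exists>\<tau>. \<tau> permutes S \<and> \<tau> ` A = B"
proof -
  have fin: "finite A" "finite B" using assms finite_subset by auto
  obtain g where g: "bij_betw g A B"
    using finite_same_card_bij[OF fin assms(4)] by auto
  have "card (S - A) = card (S - B)"
    using assms fin by (simp add: card_Diff_subset)
  then obtain h where h: "bij_betw h (S - A) (S - B)"
    using finite_same_card_bij[of "S - A" "S - B"] assms(1) by auto
  define \<tau> where "\<tau> x = (if x \<in> A then g x else if x \<in> S then h x else x)" for x
  have A: "bij_betw \<tau> A B"
    using g by (subst bij_betw_cong[of A \<tau> g]) (auto simp: \<tau>_def)
  have "bij_betw \<tau> (S - A) (S - B)"
    using h by (subst bij_betw_cong[of _ \<tau> h]) (auto simp: \<tau>_def)
  with A have "bij_betw \<tau> (A \<union> (S - A)) (B \<union> (S - B))"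
    by (rule bij_betw_combine) auto
  moreover have "A \<union> (S - A) = S" "B \<union> (S - B) = S" using assms by auto
  ultimately have "\<tau> permutes S"
    by (intro bij_imp_permutes) (use assms in \<open>auto simp: \<tau>_def\<close>)
  then show ?thesis using A by (auto simp: bij_betw_def)
qed

lemma F2_support_subset: "x \<in> F2 n \<Longrightarrow> {i. x i = 1} \<subseteq> {..<n}"
  by (fastforce simp: F2_def not_le[symmetric])

lemma F2_eq_sum_basis: "x \<in> F2 n \<Longrightarrow> x = (\<Sum>i | x i = 1. F2_basis i)"
  by (subst sum_F2_basis) (auto intro: finite_subset[OF F2_support_subset])

text \<open>Some permutation \<open>\<tau>\<close> matches the supports, so
  \<open>v = w \<circ> \<tau>\<close>, and passing from \<open>\<sigma>\<close> to
  \<open>\<tau> \<circ> \<sigma>\<close> only reorders the sum over permutations.\<close>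

lemma sym_energy_eq_if_weight_eq:
  assumes "v \<in> F2 n" "w \<in> F2 n" "weight v = weight w"
  shows "sym_energy dX n f v = sym_energy dX n f w"
proof -
  obtain \<tau> where \<tau>: "\<tau> permutes {..<n}" and im: "\<tau> ` {i. v i = 1} = {i. w i = 1}"
    using ex_permutes_image[of "{..<n}" "{i. v i = 1}" "{i. w i = 1}"] F2_support_subset assms
    by (auto simp: weight_def)
  have "v = w \<circ> \<tau>"
  proof
    fix i
    have "v i = 1 \<longleftrightarrow> w (\<tau> i) = 1"
      using im permutes_inj[OF \<tau>] by (auto dest: injD simp: set_eq_iff image_iff)
    then show "v i = (w \<circ> \<tau>) i" by (cases "v i"; cases "w (\<tau> i)") auto
  qed
  then show ?thesis
    unfolding sym_energy_def
    using setum_permutations_compose_left[OF \<tau>, of "\<lambda>\<sigma>. energy dX n f (w \<circ> \<sigma>)"]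
    by (simp add: comp_assoc)
qed

lemma weight_sum_basis: "finite A \<Longrightarrow> weight (\<Sum>i\<in>A. F2_basis i) = card A"
  by (simp add: sum_F2_basis weight_def)

lemma sym_energy_nonneg [simp]: "0 \<le> sym_energy dX n f v"
  by (simp add: sym_energy_def sum_nonneg)

lemma (in Metric_space) sym_energy_zero: "f \<in> F2 n \<rightarrow> M \<Longrightarrow> sym_energy d n f 0 = 0"
proof -
  have "0 \<circ> \<sigma> = (0 :: nat \<Rightarrow> bit)" for \<sigma> :: "nat \<Rightarrow> nat"
    by (rule ext) (simp only: comp_apply zero_fun_apply)
  then show "sym_energy d n f 0 = 0" if "f \<in> F2 n \<rightarrow> M"
    using that by (simp only: sym_energy_def energy_zero sum.neutral_const)
qed

lemma F2_ones_comp_permutes: "\<sigma> permutes {..<n} \<Longrightarrow> F2_ones n \<circ> \<sigma> = F2_ones n"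
  by (rule ext) (simp only: F2_ones_def sum_F2_basis finite_lessThan comp_apply permutes_in_image)

lemma sum_F2_basis_comp_permutes:
  assumes "\<sigma> permutes {..<n}"
  shows "(\<Sum>i<n. g (F2_basis i \<circ> \<sigma>)) = (\<Sum>i<n. g (F2_basis i))"
proof -
  have "F2_basis (\<sigma> i) \<circ> \<sigma> = F2_basis i" for i
    using permutes_inj[OF assms] by (auto simp: F2_basis_def fun_eq_iff dest: injD)
  then show ?thesis
    using sum.permute[OF assms, of "\<lambda>i. g (F2_basis i \<circ> \<sigma>)"] by (simp add: comp_def)
qed

text \<open>Coordinate permutations fix \<open>F2_ones n\<close> and permute the basis, so every
  summand repeats the unsymmetrized inequality: near-extremality of \<open>f\<close> survives
  symmetrization.\<close>

lemma sym_energy_strict_mono: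
  assumes "C * (\<Sum>i<n. energy dX n f (F2_basis i)) < energy dX n f (F2_ones n)"
  shows "C * (\<Sum>i<n. sym_energy dX n f (F2_basis i)) < sym_energy dX n f (F2_ones n)"
proof -
  let ?P = "{\<sigma>. \<sigma> permutes {..<n}}"
  have "C * (\<Sum>i<n. sym_energy dX n f (F2_basis i))
    = (\<Sum>\<sigma>\<in>?P. C * (\<Sum>i<n. energy dX n f (F2_basis i \<circ> \<sigma>)))"
    unfolding sym_energy_def by (subst sum.swap) (simp add: sum_distrib_left)
  also have "\<dots> = (\<Sum>\<sigma>\<in>?P. C * (\<Sum>i<n. energy dX n f (F2_basis i)))"
    by (intro sum.cong refl) (simp add: sum_F2_basis_comp_permutes)
  also have "\<dots> < (\<Sum>\<sigma>\<in>?P. energy dX n f (F2_ones n))"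
    using assms by (intro sum_strict_mono finite_permutations) (auto intro: permutes_id)
  also have "\<dots> = sym_energy dX n f (F2_ones n)"
    unfolding sym_energy_def by (intro sum.cong refl) (simp add: F2_ones_comp_permutes)
  finally show ?thesis .
qed

section \<open>Bounds in terms of the Hamming weight\<close>

lemma weight_F2_basis: "weight (F2_basis i) = 1"
  using weight_sum_basis[of "{i}"] by simp

lemma powr_exponent_times: "0 < k \<Longrightarrow> k powr (a - 1) * k = k powr a" for k :: real
  using powr_add[of k "a - 1" 1] by simp

text \<open>Decompose \<open>w\<close> into the basis vectors of its support, all of equal
  symmetrized energy; adding \<open>weight w\<close> equal terms raises the exponent
  \<open>2 / p - 1\<close> to \<open>2 / p\<close>.\<close>

lemma sym_energy_le_weight:
  assumes "BMW_ineq p X dX T" and f: "f \<in> F2 n \<rightarrow> X" and w: "w \<in> F2 n" "1 \<le> weight w"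
  shows "sym_energy dX n f w \<le> T\<^sup>2 * real (weight w) powr (2 / p) * sym_energy dX n f (F2_basis 0)"
proof -
  let ?A = "{i. w i = 1}" and ?k = "real (weight w)"
  have A: "?A \<subseteq> {..<n}" using w(1) by (rule F2_support_subset)
  then have "?A \<noteq> {}" using w(2) by (auto simp: weight_def)
  with A have n: "0 < n" by auto
  have "sym_energy dX n f w = sym_energy dX n f (\<Sum>i\<in>?A. F2_basis i)"
    using F2_eq_sum_basis[OF w(1)] by simp
  also have "\<dots> \<le> T\<^sup>2 * ?k powr (2 / p - 1) * (\<Sum>i\<in>?A. sym_energy dX n f (F2_basis i))"
    using assms A finite_subset[OF A]
    by (intro cube_ineq_sym_energy) (auto simp: BMW_ineq_iff_cube_ineq weight_def)
  also have "(\<Sum>i\<in>?A. sym_energy dX n f (F2_basis i)) = (\<Sum>i\<in>?A. sym_energy dX n f (F2_basis 0))"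
    using A n by (intro sum.cong refl sym_energy_eq_if_weight_eq) (auto simp: weight_F2_basis)
  also have "T\<^sup>2 * ?k powr (2 / p - 1) * \<dots>
    = T\<^sup>2 * (?k powr (2 / p - 1) * ?k) * sym_energy dX n f (F2_basis 0)"
    by (simp add: weight_def)
  finally show ?thesis using w(2) by (simp only: powr_exponent_times)
qed

text \<open>Cut the all-ones vector into \<open>m\<close> blocks of the same weight as
  \<open>w\<close>, hence of the same symmetrized energy. Read backwards, this bounds the energy of
  \<open>w\<close> from below.\<close>

lemma sym_energy_ones_le_blocks:
  assumes "BMW_ineq p X dX T" and f: "f \<in> F2 (m * weight w) \<rightarrow> X" and w: "w \<in> F2 (m * weight w)"
    and m: "1 \<le> m"
  shows "sym_energy dX (m * weight w) f (F2_ones (m * weight w))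
    \<le> T\<^sup>2 * real m powr (2 / p) * sym_energy dX (m * weight w) f w"
proof -
  define k where "k = weight w"
  let ?R = "sym_energy dX (m * k) f" and ?v = "\<lambda>j. \<Sum>i\<in>{j * k..<j * k + k}. F2_basis i"
  have v: "?v j \<in> F2 (m * k)" if "j < m" for j
  proof (rule F2_sum)
    have "Suc j * k \<le> m * k" using that by (intro mult_right_mono) auto
    then show "F2_basis i \<in> F2 (m * k)" if "i \<in> {j * k..<j * k + k}" for i
      using that by auto
  qed
  have "?R (F2_ones (m * k)) = ?R (\<Sum>j<m. ?v j)"
    by (simp add: F2_ones_def sum.nat_group)
  also have "\<dots> \<le> T\<^sup>2 * real m powr (2 / p - 1) * (\<Sum>j<m. ?R (?v j))"
    using assms v by (intro cube_ineq_sym_energy) (auto simp: BMW_ineq_iff_cube_ineq k_def)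
  also have "(\<Sum>j<m. ?R (?v j)) = (\<Sum>j<m. ?R w)"
    using v w by (intro sum.cong refl sym_energy_eq_if_weight_eq) (auto simp: weight_sum_basis k_def)
  also have "T\<^sup>2 * real m powr (2 / p - 1) * \<dots> = T\<^sup>2 * (real m powr (2 / p - 1) * real m) * ?R w"
    by simp
  finally show ?thesis using m by (simp only: powr_exponent_times k_def)
qed

section \<open>The embedding of the cube\<close>

lemma F2_dist_eq_weight:
  assumes "x \<in> F2 n" "y \<in> F2 n"
  shows "F2_dist p n x y = real (weight (x + y)) powr (1 / p)"
proof -
  have sub: "{i. (x + y) i = 1} \<subseteq> {..<n}"
    using assms by (intro F2_support_subset F2_add)
  have "(\<Sum>i<n. \<bar>of_bool (x i = 1) - of_bool (y i = 1)\<bar> powr p)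
    = (\<Sum>i<n. of_bool ((x + y) i = 1) :: real)"
  proof (intro sum.cong refl)
    fix i
    show "\<bar>of_bool (x i = 1) - of_bool (y i = 1)\<bar> powr p = (of_bool ((x + y) i = 1) :: real)"
      by (cases "x i"; cases "y i") (auto simp: plus_fun_apply)
  qed
  also have "\<dots> = real (weight (x + y))"
    using sub by (simp add: weight_def Int_absorb1)
  finally show ?thesis by (simp add: F2_dist_def lp_dist_def)
qed

text \<open>
  The coordinates of the map are \<open>f\<close> composed with all symmetries \<open>x \<mapsto> (x \<circ> \<sigma>) + z\<close> of the cube,
  so that the induced metric depends on \<open>x + y\<close> only through its weight.
\<close>
lemma ex_l2_map_sym_energy:
  assumes f: "f \<in> F2 n \<rightarrow> X"
  defines "N \<equiv> card ({\<sigma>. \<sigma> permutes {..<n}} \<times> F2 n)"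
  shows "\<exists>F \<in> F2 n \<rightarrow> l2_carrier N X. \<forall>x\<in>F2 n. \<forall>y\<in>F2 n.
    l2_dist N dX (F x) (F y) = sqrt (sym_energy dX n f (x + y))"
proof -
  let ?P = "{\<sigma>. \<sigma> permutes {..<n}} \<times> F2 n"
  have fin: "finite ?P" by (simp add: finite_permutations)
  obtain b where b: "bij_betw b {..<N} ?P"
    using ex_bij_betw_nat_finite[OF fin] by (auto simp: N_def atLeast0LessThan)
  define G where "G x q = f ((x \<circ> fst q) + snd q)" for x and q :: "(nat \<Rightarrow> nat) \<times> (nat \<Rightarrow> bit)"
  \<comment> \<open>\<open>l2_carrier\<close> consists of extensional functions, hence the
    restriction to \<open>{..<N}\<close>.\<close>
  define F where "F x = (\<lambda>i\<in>{..<N}. G x (b i))" for x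
  have "F \<in> F2 n \<rightarrow> l2_carrier N X"
  proof
    fix x assume "x \<in> F2 n"
    then have "G x q \<in> X" if "q \<in> ?P" for q
      using f that by (auto simp: G_def intro!: funcset_mem[OF f] F2_add F2_comp_permutes)
    then show "F x \<in> l2_carrier N X"
      using bij_betwE[OF b] by (auto simp: l2_carrier_def F_def)
  qed
  moreover have "l2_dist N dX (F x) (F y) = sqrt (sym_energy dX n f (x + y))"
    if xy: "x \<in> F2 n" "y \<in> F2 n" for x y
  proof -
    have "(\<Sum>i<N. (dX (F x i) (F y i))\<^sup>2) = (\<Sum>i<N. (dX (G x (b i)) (G y (b i)))\<^sup>2)"
      by (simp add: F_def)
    also have "\<dots> = (\<Sum>q\<in>?P. (dX (G x q) (G y q))\<^sup>2)"
      by (rule sum.reindex_bij_betw[OF b])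
    also have "\<dots> = (\<Sum>\<sigma> | \<sigma> permutes {..<n}. \<Sum>z\<in>F2 n. (dX (f ((x \<circ> \<sigma>) + z)) (f ((y \<circ> \<sigma>) + z)))\<^sup>2)"
      by (simp add: G_def sum.cartesian_product split_def)
    also have "\<dots> = sym_energy dX n f (x + y)"
      unfolding sym_energy_def
    proof (intro sum.cong refl)
      fix \<sigma> assume "\<sigma> \<in> {\<sigma>. \<sigma> permutes {..<n}}"
      then have x\<sigma>: "x \<circ> \<sigma> \<in> F2 n" using xy by (auto intro: F2_comp_permutes)
      \<comment> \<open>In characteristic two \<open>y\<close> is the translate of \<open>x\<close>
        by \<open>x + y\<close>; absorbing \<open>x \<circ> \<sigma>\<close> into the summation
        variable \<open>z\<close> leaves only \<open>x + y\<close>.\<close>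
      have "y = x + (x + y)" by (simp add: add.assoc[symmetric])
      then have "y (\<sigma> i) = x (\<sigma> i) + (x + y) (\<sigma> i)" for i
        by (metis plus_fun_apply)
      then have y\<sigma>: "y \<circ> \<sigma> = (x \<circ> \<sigma>) + ((x + y) \<circ> \<sigma>)"
        by (simp only: fun_eq_iff plus_fun_apply comp_apply) blast
      have "(\<Sum>z\<in>F2 n. (dX (f ((x \<circ> \<sigma>) + z)) (f ((y \<circ> \<sigma>) + z)))\<^sup>2)
        = (\<Sum>z\<in>F2 n. (dX (f (z + (x \<circ> \<sigma>))) (f (z + (x \<circ> \<sigma>) + ((x + y) \<circ> \<sigma>))))\<^sup>2)"
        by (simp only: y\<sigma> add_ac)
      then show "(\<Sum>z\<in>F2 n. (dX (f ((x \<circ> \<sigma>) + z)) (f ((y \<circ> \<sigma>) + z)))\<^sup>2) = energy dX n f ((x + y) \<circ> \<sigma>)"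
        using energy_translate[OF x\<sigma>, of dX f "(x + y) \<circ> \<sigma>"] by simp
    qed
    finally show ?thesis by (simp add: l2_dist_def L2_set_def)
  qed
  ultimately show ?thesis by blast
qed

text \<open>The slack \<open>T\<^sup>2 < D\<close> pays for \<open>f\<close> being only almost
  extremal. The dimension \<open>n\<close> depends on \<open>dim\<close> alone, so the same
  \<open>N\<close> serves every \<open>D\<close>; the \<open>+ 2\<close> ensures
  \<open>2 \<le> n\<close> even for \<open>dim = 0\<close>, as the extremality bound
  requires.\<close>

lemma (in Metric_space) ex_l2_embedding:
  fixes dim :: nat
  assumes ab: "a \<in> M" "b \<in> M" "a \<noteq> b"
    and T: "0 < T" "BMW_ineq (BMW_exponent M d) M d T" and D: "T\<^sup>2 < D"
  defines "n \<equiv> fact (dim + 2)" and "p \<equiv> BMW_exponent M d"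
  defines "N \<equiv> card ({\<sigma>. \<sigma> permutes {..<n}} \<times> F2 n)"
  shows "\<exists>s>0. \<exists>F\<in>F2 dim \<rightarrow> l2_carrier N M. \<forall>x\<in>F2 dim. \<forall>y\<in>F2 dim.
    s * F2_dist p dim x y \<le> l2_dist N d (F x) (F y) \<and>
    l2_dist N d (F x) (F y) \<le> D * s * F2_dist p dim x y"
proof -
  have le_fact: "dim + 2 \<le> n" unfolding n_def by (rule fact_ge_self)
  have D0: "0 < D" using D by (smt (verit) zero_le_power2)
  \<comment> \<open>Being below \<open>1\<close>, this factor makes the inequality fail for some
    \<open>f\<close>; its exact value gives \<open>c * r = T\<^sup>2 * s\<^sup>2\<close> for the
    scale \<open>s\<close> below.\<close>
  define c where "c = (T\<^sup>2 / D)\<^sup>2"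
  have "T\<^sup>2 / D < 1" "0 < T\<^sup>2 / D" using D D0 T by auto
  then have c: "0 < c" "c < 1" by (auto simp: c_def power_less_one_iff abs_square_less_1)
  have T': "BMW_ineq p M d T" using T(2) by (simp add: p_def)
  have "\<not> cube_ineq M d n (c * real n powr (2 / p - 1))"
  proof
    assume "cube_ineq M d n (c * real n powr (2 / p - 1))"
    then have "real n powr (2 / p - 1) \<le> c * real n powr (2 / p - 1)"
      unfolding p_def using le_fact ab by (intro cube_ineq_ge_powr_BMW_exponent) auto
    moreover have "0 < real n powr (2 / p - 1)" using le_fact by simp
    ultimately show False using c by simp
  qed
  then obtain f where f: "f \<in> F2 n \<rightarrow> M"
    and "c * real n powr (2 / p - 1) * (\<Sum>i<n. energy d n f (F2_basis i)) < energy d n f (F2_ones n)"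
    unfolding cube_ineq_def by (auto simp: not_le)
  then have less: "c * real n powr (2 / p - 1) * (\<Sum>i<n. sym_energy d n f (F2_basis i))
      < sym_energy d n f (F2_ones n)"
    by (intro sym_energy_strict_mono)
  let ?R = "sym_energy d n f"
  define r where "r = ?R (F2_basis 0)"
  have "(\<Sum>i<n. ?R (F2_basis i)) = (\<Sum>i<n. r)"
    unfolding r_def using le_fact
    by (intro sum.cong refl sym_energy_eq_if_weight_eq) (auto simp: weight_F2_basis)
  with less have "c * (real n powr (2 / p - 1) * real n) * r < ?R (F2_ones n)"
    by (simp add: mult_ac)
  then have ones: "c * real n powr (2 / p) * r < ?R (F2_ones n)"
    using le_fact by (simp add: powr_exponent_times)
  have "weight (F2_ones n) = n"
    by (simp add: F2_ones_def weight_sum_basis)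
  then have "?R (F2_ones n) \<le> T\<^sup>2 * real n powr (2 / p) * r"
    using sym_energy_le_weight[OF T' f, of "F2_ones n"] le_fact by (simp add: r_def)
  \<comment> \<open>For \<open>r = 0\<close> the energy of \<open>F2_ones n\<close> would be both
    positive and at most \<open>0\<close>.\<close>
  with ones have "r \<noteq> 0" by auto
  moreover have "0 \<le> r" by (simp add: r_def)
  ultimately have r: "0 < r" by simp
  \<comment> \<open>Chosen so that \<open>D * s = T * sqrt r\<close>, the factor in the upper bound;
    the whole slack goes into the lower bound.\<close>
  define s where "s = T * sqrt r / D"
  have s: "0 < s" using T r D0 by (simp add: s_def)
  have s2: "s\<^sup>2 = T\<^sup>2 * r / D\<^sup>2" using r by (simp add: s_def power_mult_distrib power_divide)
  obtain F where F: "F \<in> F2 n \<rightarrow> l2_carrier N M"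
    and dist: "\<And>x y. \<lbrakk>x \<in> F2 n; y \<in> F2 n\<rbrakk> \<Longrightarrow> l2_dist N d (F x) (F y) = sqrt (?R (x + y))"
    using ex_l2_map_sym_energy[OF f, of d] unfolding N_def by blast
  have sub: "F2 dim \<subseteq> F2 n" using le_fact by (intro F2_mono) simp
  have "s * F2_dist p dim x y \<le> l2_dist N d (F x) (F y) \<and>
    l2_dist N d (F x) (F y) \<le> D * s * F2_dist p dim x y" if xy: "x \<in> F2 dim" "y \<in> F2 dim" for x y
  proof (cases "weight (x + y) = 0")
    case True
    have "x + y = 0"
      using True F2_eq_sum_basis[of "x + y" dim] xy
        finite_subset[OF F2_support_subset[of "x + y" dim]] by (simp add: weight_def)
    then have "?R (x + y) = 0" using sym_energy_zero[OF f] by simp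
    then have "l2_dist N d (F x) (F y) = 0"
      using dist[of x y] xy sub by auto
    then show ?thesis
      using True xy by (simp add: F2_dist_eq_weight)
  next
    case False
    define w where "w = x + y"
    define k where "k = weight w"
    have wd: "w \<in> F2 dim" and w: "w \<in> F2 n" using xy sub by (auto simp: w_def)
    have k: "1 \<le> k" using False by (simp add: k_def w_def)
    have "k \<le> dim"
      using card_mono[OF _ F2_support_subset[OF wd]] by (simp add: k_def weight_def)
    then have "k dvd n" using k unfolding n_def by (intro dvd_fact) auto
    then obtain m where m: "n = m * k" by (metis dvd_div_mult_self)
    have m1: "1 \<le> m" using m le_fact by (cases m) auto
    \<comment> \<open>By \<open>F2_dist_eq_weight\<close> this is the distance of \<open>x\<close>
      and \<open>y\<close> in the cube.\<close>
    define u where "u = real k powr (1 / p)"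
    have u2: "u\<^sup>2 = real k powr (2 / p)"
      unfolding u_def power2_eq_square powr_add[symmetric] by simp
    have "?R w \<le> T\<^sup>2 * u\<^sup>2 * r"
      using sym_energy_le_weight[OF T' f w] k by (simp add: k_def u2 r_def)
    also have "\<dots> = (D * s * u)\<^sup>2"
      using D0 by (simp add: power_mult_distrib s2)
    finally have upper: "sqrt (?R w) \<le> D * s * u"
      using D0 s by (intro real_le_lsqrt) (auto simp: u_def)
    \<comment> \<open>Near-extremality bounds the energy of \<open>F2_ones n\<close> from below, the
      block inequality from above; with \<open>n = m * k\<close> the factor
      \<open>m powr (2 / p)\<close> cancels.\<close>
    have "(real m powr (2 / p)) * (c * u\<^sup>2 * r) = c * real n powr (2 / p) * r"
      by (simp add: m u2 powr_mult)
    also have "\<dots> < T\<^sup>2 * real m powr (2 / p) * ?R w"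
    proof -
      have "?R (F2_ones n) \<le> T\<^sup>2 * real m powr (2 / p) * ?R w"
        using sym_energy_ones_le_blocks[OF T' _ _ m1, of f w] f w
        by (simp only: m[unfolded k_def, symmetric])
      with ones show ?thesis by (rule less_le_trans)
    qed
    finally have "(real m powr (2 / p)) * (c * u\<^sup>2 * r) < (real m powr (2 / p)) * (T\<^sup>2 * ?R w)"
      by (simp add: mult_ac)
    then have "c * u\<^sup>2 * r < T\<^sup>2 * ?R w"
      using m1 by simp
    moreover have "c * u\<^sup>2 * r = T\<^sup>2 * (s * u)\<^sup>2"
      by (simp add: c_def s2 power_mult_distrib power_divide)
    ultimately have "(s * u)\<^sup>2 \<le> ?R w"
      using T(1) by simp
    then have "s * u \<le> sqrt (?R w)" by (rule real_le_rsqrt)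
    with upper show ?thesis
      using dist[OF subsetD[OF sub xy(1)] subsetD[OF sub xy(2)]] xy
      by (simp add: F2_dist_eq_weight u_def k_def w_def)
  qed
  with s F sub show ?thesis by (intro exI[of _ s] conjI bexI[of _ F]) auto
qed

section \<open>Passage to the infimum\<close>

theorem theorem1p15:
  fixes X :: "'a set" and dX :: "'a \<Rightarrow> 'a \<Rightarrow> real" and d :: nat
  assumes "Metric_space X dX"
    and "\<exists>a\<in>X. \<exists>b\<in>X. a \<noteq> b"
  shows "\<exists>N\<ge>1. distortion (l2_carrier N X) (l2_dist N dX)
                  (F2 d) (F2_dist (BMW_exponent X dX) d)
                \<le> (BMW (BMW_exponent X dX) X dX)\<^sup>2"
proof -
  interpret Metric_space X dX by fact
  obtain a b where ab: "a \<in> X" "b \<in> X" "a \<noteq> b" using assms(2) by blast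
  let ?p = "BMW_exponent X dX" and ?n = "fact (d + 2) :: nat"
  define N where "N = card ({\<sigma>. \<sigma> permutes {..<?n}} \<times> F2 ?n)"
  have "({\<sigma>. \<sigma> permutes {..<?n}} \<times> F2 ?n) \<noteq> {}"
    using permutes_id F2_0 by blast
  then have N: "1 \<le> N"
    unfolding N_def by (simp add: Suc_le_eq card_gt_0_iff finite_permutations del: card_cartesian_product)
  \<comment> \<open>Since \<open>N\<close> is already fixed, it suffices to bound the distortion by
    every \<open>E\<close> strictly above the right-hand side; if that side is infinite, there is no
    such \<open>E\<close>.\<close>
  have "distortion (l2_carrier N X) (l2_dist N dX) (F2 d) (F2_dist ?p d) \<le> E"
    if E: "(BMW ?p X dX)\<^sup>2 < E" for E :: ennreal
  proof (cases E)
    case (real D)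
    have "BMW ?p X dX < \<infinity>"
      using E real by (cases "BMW ?p X dX") (auto simp: ennreal_top_eq_mult_iff power2_eq_square)
    then obtain B where B: "BMW ?p X dX = ennreal B" "0 \<le> B"
      by (cases "BMW ?p X dX") auto
    have "B\<^sup>2 < D" using E B real by (simp add: ennreal_power ennreal_less_iff)
    then have "B < sqrt D" using B by (simp add: real_less_rsqrt)
    then have "BMW ?p X dX < ennreal (sqrt D)" using B by (simp add: ennreal_less_iff)
    then obtain T where T: "0 < T" "BMW_ineq ?p X dX T" "ennreal T < ennreal (sqrt D)"
      by (auto simp: BMW_def Inf_less_iff)
    then have "T < sqrt D" by (simp add: ennreal_less_iff)
    then have TD: "T\<^sup>2 < D"
      using T(1) real by (metis less_eq_real_def power_strict_mono real_sqrt_pow2 zero_less_numeral)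
    \<comment> \<open>\<open>distortion\<close> admits only \<open>D \<ge> 1\<close>; dimension one
      forces \<open>T\<^sup>2 \<ge> 1\<close> and hence \<open>D > 1\<close>.\<close>
    have "cube_ineq X dX 1 (T\<^sup>2)"
      using T(2) by (auto simp: BMW_ineq_iff_cube_ineq dest: spec[of _ 1])
    then have "1 \<le> T\<^sup>2" by (rule cube_ineq_ge_1[OF _ _ ab]) simp
    with ex_l2_embedding[OF ab T(1,2) TD, of d] TD show ?thesis
      unfolding distortion_def N_def real by (intro Inf_lower CollectI exI[of _ D]) auto
  qed simp
  then have "distortion (l2_carrier N X) (l2_dist N dX) (F2 d) (F2_dist ?p d) \<le> (BMW ?p X dX)\<^sup>2"
    by (rule dense_ge)
  with N show ?thesis by blast
qed

end
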